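(* Let $A$ be a domain containing $\mathbb{Q}$ with fraction field $\mathcal{K}(A)$, and let $I\subset A$ be an ideal. Let $$\sqrt[C]{I}=\{a\in A \mid \exists m\in\mathbb{N},\ \exists b\in\textstyle\sum\mathcal{K}(A)^2 \text{ such that } a^{2m}+b\in I\}$$ be its central radical. Then: 1) $\sqrt[C]{I}$ is the smallest central ideal of $A$ containing $I$. 2) $\sqrt[C]{I}=\bigcap_{\mathfrak p}\mathfrak p$, where the intersection runs over all central prime ideals $\mathfrak p$ of $A$ with $I\subset\mathfrak p$.
   Context: $\sum\mathcal{K}(A)^2$ is the set of finite sums of squares of elements of the fraction field $\mathcal{K}(A)$. An ideal $I$ of the domain $A$ (not necessarily proper) is called central if for every $a\in A$ and every $b\in\sum\mathcal{K}(A)^2$, $a^2+b\in I$ implies $a\in I$. An intersection over an empty family of ideals of $A$ is $A$. *)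

theory Defs
  imports "HOL-Computational_Algebra.Computational_Algebra"
begin

text \<open>
  The domain \<open>A\<close> is a type \<open>'a :: idom\<close>, its fraction field is \<open>'a fract\<close>, and the
  canonical embedding of \<open>A\<close> into its fraction field is \<open>to_fract\<close>.
\<close>

definition contains_rat :: "'a::comm_ring_1 itself \<Rightarrow> bool" where
  "contains_rat _ \<longleftrightarrow>
     (\<exists>f :: rat \<Rightarrow> 'a. inj f \<and> f 1 = 1 \<and>
        (\<forall>x y. f (x + y) = f x + f y) \<and> (\<forall>x y. f (x * y) = f x * f y))"

text \<open>An ideal is a submodule of the ring, viewed as a module over itself.\<close>

definition is_ideal :: "'a::comm_ring_1 set \<Rightarrow> bool" where
  "is_ideal I \<longleftrightarrow> module.subspace (*) I"

definition is_prime_ideal :: "'a::comm_ring_1 set \<Rightarrow> bool" where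
  "is_prime_ideal P \<longleftrightarrow>
     is_ideal P \<and> P \<noteq> UNIV \<and> (\<forall>a b. a * b \<in> P \<longrightarrow> a \<in> P \<or> b \<in> P)"

definition sums_of_squares :: "'k::comm_ring_1 set" where
  "sums_of_squares = {\<Sum>i<n. (f i)\<^sup>2 | (n :: nat) (f :: nat \<Rightarrow> 'k). True}"

text \<open>
  Below, \<open>b\<close> ranges over the fraction field, so the membership of \<open>a\<^sup>2 + b\<close> in \<open>I\<close> is
  taken inside the fraction field, where \<open>I\<close> is identified with its image.
\<close>

definition is_central_ideal :: "'a::idom set \<Rightarrow> bool" where
  "is_central_ideal I \<longleftrightarrow> is_ideal I \<and>
     (\<forall>a :: 'a. \<forall>b \<in> (sums_of_squares :: 'a fract set).
        (to_fract a)\<^sup>2 + b \<in> to_fract ` I \<longrightarrow> a \<in> I)"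

definition central_radical :: "'a::idom set \<Rightarrow> 'a set" where
  "central_radical I =
     {a. \<exists>m :: nat. \<exists>b \<in> (sums_of_squares :: 'a fract set).
        to_fract a ^ (2 * m) + b \<in> to_fract ` I}"

end

theory Submission
  imports Defs
begin

text \<open>
  For \<open>x\<close> outside the central radical of \<open>I\<close>, the multiplicative set \<open>M\<close> of the elements
  \<open>x ^ (2 * m) + s\<close> of \<open>A\<close>, with \<open>s\<close> a sum of squares in the fraction field, misses \<open>I\<close>. By Zorn's
  lemma there is an ideal \<open>P \<supseteq> I\<close> maximal among those that miss \<open>M\<close>, and \<open>P\<close> is prime. It is
  also central: if \<open>a\<^sup>2 + b \<in> P\<close> but \<open>a \<notin> P\<close>, then \<open>y - c a \<in> P\<close> for some \<open>y \<in> M\<close>, so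
  \<open>y\<^sup>2 - c\<^sup>2 a\<^sup>2 \<in> P\<close> and hence \<open>y\<^sup>2 + c\<^sup>2 b \<in> P \<inter> M\<close>. This gives the second claim, and the
  first one follows since intersections of central ideals are central.
\<close>

section \<open>Ideals, and primes avoiding a multiplicative set\<close>

lemma is_ideal_iff:
  fixes I :: "'a::comm_ring_1 set"
  shows "is_ideal I \<longleftrightarrow> 0 \<in> I \<and> (\<forall>x\<in>I. \<forall>y\<in>I. x + y \<in> I) \<and> (\<forall>c. \<forall>x\<in>I. c * x \<in> I)"
proof -
  interpret module "(*) :: 'a \<Rightarrow> 'a \<Rightarrow> 'a"
    by unfold_locales (simp_all add: algebra_simps)
  show ?thesis
    unfolding is_ideal_def subspace_def by blast
qed

lemma is_ideal_0: "is_ideal I \<Longrightarrow> 0 \<in> I"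
  and is_ideal_add: "is_ideal I \<Longrightarrow> x \<in> I \<Longrightarrow> y \<in> I \<Longrightarrow> x + y \<in> I"
  and is_ideal_mult: "is_ideal I \<Longrightarrow> x \<in> I \<Longrightarrow> c * x \<in> I"
  by (simp_all add: is_ideal_iff)

lemma is_ideal_Inter:
  assumes "\<And>I. I \<in> \<I> \<Longrightarrow> is_ideal I"
  shows "is_ideal (\<Inter>\<I>)"
  using assms unfolding is_ideal_iff by blast

lemma is_ideal_Union_chain:
  assumes "\<C> \<noteq> {}" "\<And>I. I \<in> \<C> \<Longrightarrow> is_ideal I"
    and chain: "\<And>I J. I \<in> \<C> \<Longrightarrow> J \<in> \<C> \<Longrightarrow> I \<subseteq> J \<or> J \<subseteq> I"
  shows "is_ideal (\<Union>\<C>)"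
  unfolding is_ideal_iff
proof (intro conjI ballI allI)
  show "0 \<in> \<Union>\<C>"
    using assms(1,2) is_ideal_0 by blast
  show "x + y \<in> \<Union>\<C>" if xy: "x \<in> \<Union>\<C>" "y \<in> \<Union>\<C>" for x y
  proof -
    obtain I J where IJ: "I \<in> \<C>" "J \<in> \<C>" "x \<in> I" "y \<in> J"
      using xy by blast
    with chain[of I J] have "\<exists>L\<in>\<C>. x \<in> L \<and> y \<in> L"
      by blast
    with assms(2) show ?thesis
      by (blast intro: is_ideal_add)
  qed
  show "c * x \<in> \<Union>\<C>" if "x \<in> \<Union>\<C>" for c x
    using that assms(2) is_ideal_mult by blast
qed

text \<open>The set is the ideal \<open>P + (a)\<close>, written so that membership hands over the
  coefficient \<open>c\<close> directly.\<close>

lemma is_ideal_insert_generator: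
  assumes "is_ideal P"
  shows "is_ideal {y. \<exists>c. y - c * a \<in> P}" (is "is_ideal ?Q")
  unfolding is_ideal_iff
proof (intro conjI ballI allI)
  show "0 \<in> ?Q"
    using is_ideal_0[OF assms] by (auto intro: exI[of _ 0])
  show "x + y \<in> ?Q" if xy: "x \<in> ?Q" "y \<in> ?Q" for x y
  proof -
    obtain c d where "x - c * a \<in> P" "y - d * a \<in> P"
      using xy by blast
    from is_ideal_add[OF assms this] have "(x + y) - (c + d) * a \<in> P"
      by (simp add: algebra_simps)
    then show ?thesis by blast
  qed
  show "r * x \<in> ?Q" if x: "x \<in> ?Q" for r x
  proof -
    obtain c where "x - c * a \<in> P"
      using x by blast
    from is_ideal_mult[OF assms this, of r] have "r * x - (r * c) * a \<in> P"
      by (simp add: algebra_simps)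
    then show ?thesis by blast
  qed
qed

text \<open>An ideal maximal among those containing \<open>I\<close> and missing \<open>M\<close> is
  prime. The last conclusion exports this maximality in the form "\<open>P + (a)\<close> meets
  \<open>M\<close>", because the later proof that \<open>P\<close> is central needs more than
  primeness.\<close>

lemma prime_ideal_disjoint_multiplicative_set:
  fixes I M :: "'a::comm_ring_1 set"
  assumes "is_ideal I" "I \<inter> M = {}" "1 \<in> M"
    and M_mult: "\<And>x y. x \<in> M \<Longrightarrow> y \<in> M \<Longrightarrow> x * y \<in> M"
  obtains P where "is_prime_ideal P" "I \<subseteq> P" "P \<inter> M = {}"
    and "\<And>a. a \<notin> P \<Longrightarrow> \<exists>y\<in>M. \<exists>c. y - c * a \<in> P"
proof -
  define \<J> where "\<J> = {J. is_ideal J \<and> I \<subseteq> J \<and> J \<inter> M = {}}"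
  have "\<exists>P\<in>\<J>. \<forall>Q\<in>\<J>. P \<subseteq> Q \<longrightarrow> Q = P"
  proof (rule subset_Zorn_nonempty)
    show "\<J> \<noteq> {}"
      using assms(1,2) by (auto simp: \<J>_def)
    show "\<Union>\<C> \<in> \<J>" if "\<C> \<noteq> {}" and chain: "subset.chain \<J> \<C>" for \<C>
    proof -
      have \<C>: "is_ideal J" "I \<subseteq> J" "J \<inter> M = {}" if "J \<in> \<C>" for J
        using chain that by (auto simp: subset_chain_def \<J>_def)
      have "is_ideal (\<Union>\<C>)"
        using \<open>\<C> \<noteq> {}\<close> \<C>(1) chain by (intro is_ideal_Union_chain) (auto simp: subset_chain_def)
      moreover have "I \<subseteq> \<Union>\<C>" "\<Union>\<C> \<inter> M = {}"
        using \<open>\<C> \<noteq> {}\<close> \<C>(2,3) by fast+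
      ultimately show ?thesis
        by (simp add: \<J>_def)
    qed
  qed
  then obtain P where "P \<in> \<J>" and P_max: "\<forall>Q\<in>\<J>. P \<subseteq> Q \<longrightarrow> Q = P"
    by (rule bexE)
  then have P: "is_ideal P" "I \<subseteq> P" "P \<inter> M = {}"
    by (simp_all add: \<J>_def)
  have max: "Q = P" if "is_ideal Q" "Q \<inter> M = {}" "P \<subseteq> Q" for Q
  proof -
    have "Q \<in> \<J>"
      using that P(2) by (auto simp: \<J>_def)
    with P_max that(3) show ?thesis by simp
  qed
  have meets: "\<exists>y\<in>M. \<exists>c. y - c * a \<in> P" if "a \<notin> P" for a
  proof (rule ccontr)
    assume neg: "\<not> ?thesis"
    let ?Q = "{y. \<exists>c. y - c * a \<in> P}"
    have "P \<subseteq> ?Q"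
      by (auto intro: exI[of _ 0])
    then have "?Q = P"
      \<comment> \<open>By \<open>neg\<close> the ideal \<open>P + (a)\<close> misses
        \<open>M\<close>, so maximality collapses it to \<open>P\<close>, although it contains
        \<open>a\<close>.\<close>
      using neg by (intro max is_ideal_insert_generator P(1)) auto
    moreover have "a \<in> ?Q"
      using is_ideal_0[OF P(1)] by (auto intro: exI[of _ 1])
    ultimately show False
      using that by blast
  qed
  have "a \<in> P \<or> b \<in> P" if ab: "a * b \<in> P" for a b
  proof (rule ccontr)
    assume "\<not> (a \<in> P \<or> b \<in> P)"
    then obtain y z c d where yz: "y \<in> M" "z \<in> M" and *: "y - c * a \<in> P" "z - d * b \<in> P"
      using meets by meson
    \<comment> \<open>Each summand on the right is a multiple of one of \<open>y - c * a\<close>,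
      \<open>z - d * b\<close> and \<open>a * b\<close>, all of which lie in
      \<open>P\<close>.\<close>
    have "y * z = z * (y - c * a) + (c * a * (z - d * b) + c * d * (a * b))"
      by (simp add: algebra_simps)
    also have "\<dots> \<in> P"
      by (intro is_ideal_add P(1) is_ideal_mult[OF P(1) *(1)] is_ideal_mult[OF P(1) *(2)]
          is_ideal_mult[OF P(1) ab])
    finally show False
      using M_mult[OF yz] P(3) by blast
  qed
  then have "is_prime_ideal P"
    using P(1,3) \<open>1 \<in> M\<close> unfolding is_prime_ideal_def by blast
  with P(2,3) meets show thesis
    using that by blast
qed

section \<open>Closure properties of sums of squares\<close>

lemma sums_of_squares_0: "0 \<in> sums_of_squares"
  unfolding sums_of_squares_def by (auto intro: exI[of _ 0])

lemma sums_of_squares_add_square: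
  fixes s x :: "'a::comm_ring_1"
  assumes "s \<in> sums_of_squares"
  shows "s + x\<^sup>2 \<in> sums_of_squares"
proof -
  obtain n and f :: "nat \<Rightarrow> 'a" where s: "s = (\<Sum>i<n. (f i)\<^sup>2)"
    using assms unfolding sums_of_squares_def by blast
  have "s + x\<^sup>2 = (\<Sum>i<Suc n. ((f(n := x)) i)\<^sup>2)"
    by (simp add: s)
  then show ?thesis
    unfolding sums_of_squares_def by blast
qed

text \<open>Induction on the number of squares, freeing the closure proofs below from indexed
  sums.\<close>

lemma sums_of_squares_induct [consumes 1, case_names zero add_square]:
  fixes s :: "'a::comm_ring_1"
  assumes "s \<in> sums_of_squares" "P 0"
    and step: "\<And>s x. s \<in> sums_of_squares \<Longrightarrow> P s \<Longrightarrow> P (s + x\<^sup>2)"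
  shows "P s"
proof -
  obtain n and f :: "nat \<Rightarrow> 'a" where s: "s = (\<Sum>i<n. (f i)\<^sup>2)"
    using assms(1) unfolding sums_of_squares_def by blast
  have "P (\<Sum>i<n. (f i)\<^sup>2)"
  proof (induction n)
    case (Suc n)
    have "(\<Sum>i<n. (f i)\<^sup>2) \<in> sums_of_squares"
      unfolding sums_of_squares_def by blast
    from step[OF this Suc] show ?case by simp
  qed (simp add: assms(2))
  with s show ?thesis by simp
qed

lemma sums_of_squares_square: "x\<^sup>2 \<in> sums_of_squares"
  using sums_of_squares_add_square[OF sums_of_squares_0, of x] by simp

lemma sums_of_squares_add:
  assumes "s \<in> sums_of_squares" "t \<in> sums_of_squares"
  shows "s + t \<in> sums_of_squares"
  using assms(2)
proof (induction t rule: sums_of_squares_induct)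
  case (add_square t x)
  then show ?case
    using sums_of_squares_add_square[of "s + t" x] by (simp add: add.assoc)
qed (simp add: assms(1))

lemma sums_of_squares_square_mult:
  assumes "s \<in> sums_of_squares"
  shows "x\<^sup>2 * s \<in> sums_of_squares"
  using assms
proof (induction s rule: sums_of_squares_induct)
  case (add_square s y)
  then show ?case
    using sums_of_squares_add_square[of "x\<^sup>2 * s" "x * y"]
    by (simp add: distrib_left power_mult_distrib)
qed (simp add: sums_of_squares_0)

lemma sums_of_squares_mult:
  assumes "s \<in> sums_of_squares" "t \<in> sums_of_squares"
  shows "s * t \<in> sums_of_squares"
  using assms(1)
proof (induction s rule: sums_of_squares_induct)
  case (add_square s x)
  then show ?case
    using sums_of_squares_add[OF _ sums_of_squares_square_mult[OF assms(2), of x]]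
    by (simp add: distrib_right)
qed (simp add: sums_of_squares_0)

lemma sums_of_squares_even_power: "x ^ (2 * m) \<in> sums_of_squares"
  using sums_of_squares_square[of "x ^ m"] by (simp add: power_mult mult.commute)

section \<open>Central ideals and the central radical\<close>

lemma is_central_ideal_Inter:
  assumes "\<And>I. I \<in> \<I> \<Longrightarrow> is_central_ideal I"
  shows "is_central_ideal (\<Inter>\<I>)"
proof -
  have "is_ideal (\<Inter>\<I>)"
    using assms by (intro is_ideal_Inter) (auto simp: is_central_ideal_def)
  then show ?thesis
    using assms unfolding is_central_ideal_def by blast
qed

lemma to_fract_power: "to_fract (x ^ n) = to_fract x ^ n"
  by (induction n) simp_all

text \<open>Centrality with \<open>b = 0\<close> says that squares can be cancelled. For
  \<open>m >= 2\<close> the multiple \<open>a ^ (2 * (m - 1))\<close> of \<open>a ^ m\<close> is a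
  square, so the exponent drops by one; for \<open>m = 0\<close> the ideal contains 1.\<close>

lemma is_central_ideal_power_cancel:
  assumes J: "is_central_ideal J" and "a ^ m \<in> J"
  shows "a \<in> J"
  using assms(2)
proof (induction m rule: less_induct)
  case (less m)
  have ideal: "is_ideal J"
    using J by (simp add: is_central_ideal_def)
  consider "m = 0" | "m = 1" | "m \<ge> 2" by linarith
  then show ?case
  proof cases
    case 1
    then show ?thesis
      using is_ideal_mult[OF ideal less.prems, of a] by simp
  next
    case 2
    then show ?thesis using less.prems by simp
  next
    case 3
    have "a ^ (m - 2) * a ^ m \<in> J"
      using is_ideal_mult[OF ideal less.prems] .
    moreover have "(m - 2) + m = (m - 1) * 2"
      using 3 by simp
    then have "a ^ (m - 2) * a ^ m = (a ^ (m - 1))\<^sup>2"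
      by (simp only: flip: power_add power_mult)
    ultimately have "(to_fract (a ^ (m - 1)))\<^sup>2 + 0 \<in> to_fract ` J"
      by (simp flip: to_fract_power)
    then have "a ^ (m - 1) \<in> J"
      using J sums_of_squares_0 unfolding is_central_ideal_def by blast
    then show ?thesis
      using less.IH[of "m - 1"] 3 by simp
  qed
qed

lemma subset_central_radical:
  assumes "is_ideal I"
  shows "I \<subseteq> central_radical I"
proof
  fix a assume "a \<in> I"
  then have "a * a \<in> I"
    by (rule is_ideal_mult[OF assms])
  then have "to_fract a ^ (2 * 1) + 0 \<in> to_fract ` I"
    by (simp add: power2_eq_square flip: to_fract_mult)
  then show "a \<in> central_radical I"
    unfolding central_radical_def using sums_of_squares_0 by blast
qed

lemma central_radical_least:
  assumes J: "is_central_ideal J" and "I \<subseteq> J"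
  shows "central_radical I \<subseteq> J"
proof
  fix a assume "a \<in> central_radical I"
  then obtain m b where "b \<in> sums_of_squares" and mem: "to_fract a ^ (2 * m) + b \<in> to_fract ` I"
    unfolding central_radical_def by blast
  \<comment> \<open>Centrality speaks of squares only, so \<open>a ^ (2 * m)\<close> is read as the
    square of \<open>a ^ m\<close>.\<close>
  moreover have "(to_fract (a ^ m))\<^sup>2 + b \<in> to_fract ` J"
    using mem \<open>I \<subseteq> J\<close> by (auto simp: to_fract_power mult.commute simp flip: power_mult)
  ultimately have "a ^ m \<in> J"
    using J unfolding is_central_ideal_def by blast
  then show "a \<in> J"
    by (rule is_central_ideal_power_cancel[OF J])
qed

lemma central_prime_avoiding:
  fixes I :: "'a::idom set"
  assumes "is_ideal I" "x \<notin> central_radical I"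
  obtains P where "is_prime_ideal P" "is_central_ideal P" "I \<subseteq> P" "x \<notin> P"
proof -
  define S :: "'a fract set" where "S = sums_of_squares"
  define M where "M = {y. \<exists>m. \<exists>s\<in>S. to_fract y = to_fract x ^ (2 * m) + s}"
  \<comment> \<open>The summand \<open>s\<close> may lie outside \<open>A\<close>; the element
    \<open>y\<close> records that the sum is nevertheless in \<open>A\<close>.\<close>
  have M_add: "y \<in> M" if "z \<in> M" "s \<in> S" "to_fract y = to_fract z + s" for y z s
    using that sums_of_squares_add unfolding M_def S_def by (fastforce simp: add.assoc)
  have M_mult: "y * z \<in> M" if yz: "y \<in> M" "z \<in> M" for y z
  proof -
    obtain m s n t where st: "s \<in> S" "t \<in> S"
      and y: "to_fract y = to_fract x ^ (2 * m) + s"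
      and z: "to_fract z = to_fract x ^ (2 * n) + t"
      using yz unfolding M_def by blast
    \<comment> \<open>These are all terms of the expanded product except the leading power of
      \<open>x\<close>.\<close>
    let ?u = "to_fract x ^ (2 * m) * t + (s * to_fract x ^ (2 * n) + s * t)"
    have "?u \<in> S"
      using st unfolding S_def
      by (intro sums_of_squares_add sums_of_squares_mult sums_of_squares_even_power)
    moreover have "to_fract (y * z) = to_fract x ^ (2 * (m + n)) + ?u"
      by (simp add: y z algebra_simps power_add)
    ultimately show ?thesis
      unfolding M_def by blast
  qed
  have "1 \<in> M"
    unfolding M_def S_def using sums_of_squares_0 by (auto intro!: exI[of _ 0] bexI[of _ 0])
  \<comment> \<open>Exponents in \<open>M\<close> are even, so \<open>x\<close> is kept out of
    \<open>P\<close> through its square.\<close>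
  have "x\<^sup>2 \<in> M"
    unfolding M_def S_def using sums_of_squares_0
    by (auto intro!: exI[of _ 1] bexI[of _ 0] simp: to_fract_power)
  \<comment> \<open>A common element would witness that \<open>x\<close> lies in the central
    radical.\<close>
  have "I \<inter> M = {}"
    using assms(2) unfolding M_def S_def central_radical_def by force
  then obtain P where P: "is_prime_ideal P" "I \<subseteq> P" "P \<inter> M = {}"
    and meets: "\<And>a. a \<notin> P \<Longrightarrow> \<exists>y\<in>M. \<exists>c. y - c * a \<in> P"
    using prime_ideal_disjoint_multiplicative_set[OF assms(1) _ \<open>1 \<in> M\<close> M_mult] by metis
  have ideal: "is_ideal P"
    using P(1) by (simp add: is_prime_ideal_def)
  have "x \<notin> P"
    using is_ideal_mult[OF ideal, of x x] \<open>x\<^sup>2 \<in> M\<close> P(3) by (auto simp: power2_eq_square)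
  moreover have "a \<in> P" if b: "b \<in> S" and mem: "(to_fract a)\<^sup>2 + b \<in> to_fract ` P" for a b
  proof (rule ccontr)
    assume "a \<notin> P"
    then obtain y c where y: "y \<in> M" "y - c * a \<in> P"
      using meets by blast
    obtain p where p: "p \<in> P" "to_fract p = (to_fract a)\<^sup>2 + b"
      using mem by force
    \<comment> \<open>In the fraction field \<open>?z\<close> equals
      \<open>y\<^sup>2 + c\<^sup>2 * b\<close>. The form chosen here stays inside \<open>A\<close>
      and shows membership in \<open>P\<close>.\<close>
    let ?z = "(y + c * a) * (y - c * a) + c\<^sup>2 * p"
    have "?z \<in> P"
      using y(2) p(1) by (intro is_ideal_add is_ideal_mult ideal)
    moreover have "?z \<in> M"
    proof (rule M_add)
      show "y * y \<in> M"
        using M_mult y(1) by blast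
      show "(to_fract c)\<^sup>2 * b \<in> S"
        using b unfolding S_def by (rule sums_of_squares_square_mult)
      show "to_fract ?z = to_fract (y * y) + (to_fract c)\<^sup>2 * b"
        by (simp add: p(2) to_fract_power algebra_simps power2_eq_square)
    qed
    ultimately show False
      using P(3) by blast
  qed
  then have "is_central_ideal P"
    using ideal unfolding is_central_ideal_def S_def by blast
  ultimately show thesis
    using that P(1,2) by blast
qed

theorem proposition3p14:
  fixes I :: "'a::idom set"
  assumes "contains_rat TYPE('a)"
    and "is_ideal I"
  shows "(is_central_ideal (central_radical I) \<and> I \<subseteq> central_radical I \<and>
          (\<forall>J. is_central_ideal J \<and> I \<subseteq> J \<longrightarrow> central_radical I \<subseteq> J)) \<and>
         central_radical I = \<Inter>{P. is_prime_ideal P \<and> is_central_ideal P \<and> I \<subseteq> P}"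
proof -
  have eq: "central_radical I = \<Inter>{P. is_prime_ideal P \<and> is_central_ideal P \<and> I \<subseteq> P}"
    (is "_ = \<Inter>?\<P>")
  proof
    show "central_radical I \<subseteq> \<Inter>?\<P>"
      using central_radical_least by blast
    show "\<Inter>?\<P> \<subseteq> central_radical I"
      using central_prime_avoiding[OF assms(2)] by blast
  qed
  \<comment> \<open>The family may be empty: if -1 is a sum of squares in the fraction field, the
    only central ideal is \<open>UNIV\<close>, and both sides of \<open>eq\<close> are
    \<open>UNIV\<close>.\<close>
  moreover have "is_central_ideal (\<Inter>?\<P>)"
    by (rule is_central_ideal_Inter) blast
  ultimately have "is_central_ideal (central_radical I)"
    by simp
  with eq subset_central_radical[OF assms(2)] central_radical_least show ?thesis
    by blast
qed

end
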